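(* Let $\mathcal L$ be a finite relational signature, $\mathscr D$ a nonprincipal ultrafilter over $\omega$, $(\mathcal M_t)_{t\in\omega}$ a $\mathscr D$-trending sequence of finite $\mathcal L$-structures, and $\mathfrak M^*=\prod_{t\in\omega}\mathcal M_t/\mathscr D$. Let $\mathfrak N$ be an $\mathcal L$-structure of cardinality at most $\aleph_1$ such that $\mathcal K:=\mathrm{age}(\mathfrak N)\subseteq\bigcup\{\mathrm{age}(\mathcal M_t):t\in\omega\}$. Let $\mathcal A\in\mathcal K$ have finite small Ramsey degree $d=d(\mathcal A,\mathcal K)$ in $\mathcal K$. Then for every $k\in\omega$, $\mathfrak M^*\longrightarrow_{\mathrm{int}}(\mathfrak N)^{\mathcal A}_{k,d}$.
   Context: $\mathrm{age}(\mathfrak N)$: class of finite structures embeddable in $\mathfrak N$. $\mathscr D$-trending: (1) $|M_s|\le|M_t|$ for $s<t$; (2) $|M_t|\to\infty$; (3) $\{t:\mathcal M_i\hookrightarrow\mathcal M_t\}\in\mathscr D$ for each $i$. $\binom{\mathfrak N}{\mathfrak M}$: set of substructures of $\mathfrak N$ isomorphic to $\mathfrak M$. $\mathcal C\longrightarrow(\mathcal B)^{\mathcal A}_{k,\ell}$ means: for every $c:\binom{\mathcal C}{\mathcal A}\to k$ there is a copy $\mathcal B'$ of $\mathcal B$ in $\mathcal C$ with $|c''\binom{\mathcal B'}{\mathcal A}|\le\ell$. $\mathcal A$ has finite small Ramsey degree in $\mathcal K$ if some $\ell\in\omega$ satisfies: for all $k$ and $\mathcal B\in\mathcal K$ there is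 $\mathcal C\in\mathcal K$ with $\mathcal C\longrightarrow(\mathcal B)^{\mathcal A}_{k,\ell}$; the least such $\ell$ is $d(\mathcal A,\mathcal K)$. Internal colorings: for a substructure $\mathcal A'$ of $\mathfrak M^*$, $\mathcal A'[t]$ is the substructure of $\mathcal M_t$ on $\{a[t]:a\in A'\}$; a $k$-coloring $c^*$ of copies of $\mathcal A$ in $\mathfrak M^*$ is internal if there exist $Z\in\mathscr D$ and $k$-colorings $c_t$ of copies of $\mathcal A$ in $\mathcal M_t$ ($t\in Z$) such that $c^*(\mathcal A')=j$ iff $\{t\in Z:\mathcal A'[t]\cong\mathcal A',\ c_t(\mathcal A'[t])=j\}\in\mathscr D$. $\mathfrak M^*\longrightarrow_{\mathrm{int}}(\mathfrak N)^{\mathcal A}_{k,\ell}$ means: for every internal $k$-coloring $c$ of copies of $\mathcal A$ in $\mathfrak M^*$ there is a copy $\mathfrak N'$ of $\mathfrak N$ in $\mathfrak M^*$ with $c$ taking at most $\ell$ values on $\binom{\mathfrak N'}{\mathcal A}$. *)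

theory Defs
  imports Main
begin

record ('a, 'r) struc =
  carr :: "'a set"
  rels :: "'r \<Rightarrow> 'a list \<Rightarrow> bool"

definition is_struc :: "'r set \<Rightarrow> ('r \<Rightarrow> nat) \<Rightarrow> ('a, 'r) struc \<Rightarrow> bool" where
  "is_struc L ar S \<longleftrightarrow>
     (\<forall>R xs. rels S R xs \<longrightarrow> R \<in> L \<and> length xs = ar R \<and> set xs \<subseteq> carr S)"

definition preserves :: "'r set \<Rightarrow> ('r \<Rightarrow> nat) \<Rightarrow> ('a, 'r) struc \<Rightarrow> ('b, 'r) struc \<Rightarrow> ('a \<Rightarrow> 'b) \<Rightarrow> bool" where
  "preserves L ar A B h \<longleftrightarrow>
     (\<forall>R\<in>L. \<forall>xs. length xs = ar R \<and> set xs \<subseteq> carr A \<longrightarrow>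
        (rels A R xs \<longleftrightarrow> rels B R (map h xs)))"

definition embedding :: "'r set \<Rightarrow> ('r \<Rightarrow> nat) \<Rightarrow> ('a, 'r) struc \<Rightarrow> ('b, 'r) struc \<Rightarrow> ('a \<Rightarrow> 'b) \<Rightarrow> bool" where
  "embedding L ar A B h \<longleftrightarrow> inj_on h (carr A) \<and> h ` carr A \<subseteq> carr B \<and> preserves L ar A B h"

definition embeds :: "'r set \<Rightarrow> ('r \<Rightarrow> nat) \<Rightarrow> ('a, 'r) struc \<Rightarrow> ('b, 'r) struc \<Rightarrow> bool" where
  "embeds L ar A B \<longleftrightarrow> (\<exists>h. embedding L ar A B h)"

definition isomorphic :: "'r set \<Rightarrow> ('r \<Rightarrow> nat) \<Rightarrow> ('a, 'r) struc \<Rightarrow> ('b, 'r) struc \<Rightarrow> bool" where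
  "isomorphic L ar A B \<longleftrightarrow> (\<exists>h. bij_betw h (carr A) (carr B) \<and> preserves L ar A B h)"

definition induced :: "('a, 'r) struc \<Rightarrow> 'a set \<Rightarrow> ('a, 'r) struc" where
  "induced S X = \<lparr> carr = X, rels = (\<lambda>R xs. rels S R xs \<and> set xs \<subseteq> X) \<rparr>"

text \<open>copies S A = binom(S, A): substructures of S isomorphic to A, identified with
their (induced) carriers.\<close>

definition copies :: "'r set \<Rightarrow> ('r \<Rightarrow> nat) \<Rightarrow> ('a, 'r) struc \<Rightarrow> ('b, 'r) struc \<Rightarrow> 'a set set" where
  "copies L ar S A = {X. X \<subseteq> carr S \<and> isomorphic L ar (induced S X) A}"

text \<open>Age: finite L-structures embeddable in N.  Since every finite structure is
isomorphic to one whose elements are natural numbers, we represent the class by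
structures on nat.\<close>

definition age :: "'r set \<Rightarrow> ('r \<Rightarrow> nat) \<Rightarrow> ('a, 'r) struc \<Rightarrow> (nat, 'r) struc set" where
  "age L ar N = {B. is_struc L ar B \<and> finite (carr B) \<and> embeds L ar B N}"

definition arrow :: "'r set \<Rightarrow> ('r \<Rightarrow> nat) \<Rightarrow> ('c, 'r) struc \<Rightarrow> ('b, 'r) struc \<Rightarrow> ('a, 'r) struc
                     \<Rightarrow> nat \<Rightarrow> nat \<Rightarrow> bool" where
  "arrow L ar C B A k l \<longleftrightarrow>
     (\<forall>c :: 'c set \<Rightarrow> nat. (\<forall>X\<in>copies L ar C A. c X < k) \<longrightarrow>
        (\<exists>Y\<in>copies L ar C B. card (c ` copies L ar (induced C Y) A) \<le> l))"

definition ramsey_bound :: "'r set \<Rightarrow> ('r \<Rightarrow> nat) \<Rightarrow> (nat, 'r) struc set \<Rightarrow> (nat, 'r) struc \<Rightarrow> nat \<Rightarrow> bool" where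
  "ramsey_bound L ar K A l \<longleftrightarrow>
     (\<forall>k B. B \<in> K \<longrightarrow> (\<exists>C\<in>K. arrow L ar C B A k l))"

definition finite_small_ramsey_degree :: "'r set \<Rightarrow> ('r \<Rightarrow> nat) \<Rightarrow> (nat, 'r) struc set \<Rightarrow> (nat, 'r) struc \<Rightarrow> bool" where
  "finite_small_ramsey_degree L ar K A \<longleftrightarrow> (\<exists>l. ramsey_bound L ar K A l)"

definition small_ramsey_degree :: "'r set \<Rightarrow> ('r \<Rightarrow> nat) \<Rightarrow> (nat, 'r) struc set \<Rightarrow> (nat, 'r) struc \<Rightarrow> nat" where
  "small_ramsey_degree L ar K A = (LEAST l. ramsey_bound L ar K A l)"

definition card_le_aleph1 :: "'a set \<Rightarrow> bool" where
  "card_le_aleph1 X \<longleftrightarrow> (card_of X, cardSuc natLeq) \<in> ordLeq"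

definition ultrafilter_on_nat :: "nat set set \<Rightarrow> bool" where
  "ultrafilter_on_nat D \<longleftrightarrow>
     UNIV \<in> D \<and> {} \<notin> D \<and>
     (\<forall>X Y. X \<in> D \<and> X \<subseteq> Y \<longrightarrow> Y \<in> D) \<and>
     (\<forall>X Y. X \<in> D \<and> Y \<in> D \<longrightarrow> X \<inter> Y \<in> D) \<and>
     (\<forall>X. X \<in> D \<or> - X \<in> D)"

definition nonprincipal :: "nat set set \<Rightarrow> bool" where
  "nonprincipal D \<longleftrightarrow> (\<forall>X\<in>D. infinite X)"

definition uclass :: "nat set set \<Rightarrow> (nat \<Rightarrow> 'm) \<Rightarrow> (nat \<Rightarrow> 'm) set" where
  "uclass D f = {g. {t. g t = f t} \<in> D}"

definition rep :: "(nat \<Rightarrow> 'm) set \<Rightarrow> nat \<Rightarrow> 'm" where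
  "rep a = (SOME f. f \<in> a)"

definition ultraproduct :: "nat set set \<Rightarrow> (nat \<Rightarrow> ('m, 'r) struc) \<Rightarrow> ((nat \<Rightarrow> 'm) set, 'r) struc" where
  "ultraproduct D M =
     (let U = {uclass D f | f. {t. f t \<in> carr (M t)} \<in> D}
      in \<lparr> carr = U,
           rels = (\<lambda>R as. set as \<subseteq> U \<and> {t. rels (M t) R (map (\<lambda>a. rep a t) as)} \<in> D) \<rparr>)"

definition trending :: "'r set \<Rightarrow> ('r \<Rightarrow> nat) \<Rightarrow> nat set set \<Rightarrow> (nat \<Rightarrow> ('m, 'r) struc) \<Rightarrow> bool" where
  "trending L ar D M \<longleftrightarrow>
     (\<forall>s t. s < t \<longrightarrow> card (carr (M s)) \<le> card (carr (M t))) \<and>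
     filterlim (\<lambda>t. card (carr (M t))) at_top sequentially \<and>
     (\<forall>i. {t. embeds L ar (M i) (M t)} \<in> D)"

definition slice :: "(nat \<Rightarrow> 'm) set set \<Rightarrow> nat \<Rightarrow> 'm set" where
  "slice X t = (\<lambda>a. rep a t) ` X"

definition internal_colouring ::
  "'r set \<Rightarrow> ('r \<Rightarrow> nat) \<Rightarrow> nat set set \<Rightarrow> (nat \<Rightarrow> ('m, 'r) struc) \<Rightarrow> ('a, 'r) struc \<Rightarrow> nat
    \<Rightarrow> ((nat \<Rightarrow> 'm) set set \<Rightarrow> nat) \<Rightarrow> bool" where
  "internal_colouring L ar D M A k c \<longleftrightarrow>
     (let Ms = ultraproduct D M in
      (\<forall>X\<in>copies L ar Ms A. c X < k) \<and>
      (\<exists>Z\<in>D. \<exists>ct :: nat \<Rightarrow> 'm set \<Rightarrow> nat.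
         (\<forall>t\<in>Z. \<forall>Y\<in>copies L ar (M t) A. ct t Y < k) \<and>
         (\<forall>X\<in>copies L ar Ms A. \<forall>j.
            c X = j \<longleftrightarrow>
            {t\<in>Z. isomorphic L ar (induced (M t) (slice X t)) (induced Ms X)
                  \<and> ct t (slice X t) = j} \<in> D)))"

definition int_arrow ::
  "'r set \<Rightarrow> ('r \<Rightarrow> nat) \<Rightarrow> nat set set \<Rightarrow> (nat \<Rightarrow> ('m, 'r) struc) \<Rightarrow> ('n, 'r) struc
    \<Rightarrow> ('a, 'r) struc \<Rightarrow> nat \<Rightarrow> nat \<Rightarrow> bool" where
  "int_arrow L ar D M N A k l \<longleftrightarrow>
     (\<forall>c. internal_colouring L ar D M A k c \<longrightarrow>
        (\<exists>Y\<in>copies L ar (ultraproduct D M) N.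
           card (c ` copies L ar (induced (ultraproduct D M) Y) A) \<le> l))"

end

theory Submission
  imports Defs "HOL-Library.Countable_Set_Type"
begin

text \<open>
  By pigeonhole and directedness of the age, one set \<open>S\<close> of at most \<open>d\<close> colours works for all
  finite \<open>F \<subseteq> N\<close> at once: for \<open>D\<close>-many \<open>t\<close>, \<open>F\<close> embeds into \<open>M t\<close> so that copies of \<open>A\<close> inside
  the image have colours in \<open>S\<close>. Call such embeddings good. Well-order \<open>N\<close> so that initial
  segments are countable and choose the image of each point by transfinite recursion, keeping
  the invariant that for every finite \<open>F \<subseteq> N\<close>, the part of the map already defined on \<open>F\<close>
  extends, for \<open>D\<close>-many \<open>t\<close>, to a good embedding of \<open>F\<close>. Since the signature is finite, a
  countable set has only countably many isomorphism types of finite \<open>F\<close> over it, so each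
  step realises countably many conditions and countable saturation suffices.
\<close>

section \<open>Ultrafilters on the natural numbers\<close>

lemma ultrafilter_mono:
  assumes "ultrafilter_on_nat D" "X \<in> D" "\<And>t. t \<in> X \<Longrightarrow> t \<in> Y"
  shows "Y \<in> D"
  using assms unfolding ultrafilter_on_nat_def by (metis subsetI)

lemma ultrafilter_Int:
  assumes "ultrafilter_on_nat D" "X \<in> D" "Y \<in> D"
  shows "X \<inter> Y \<in> D"
  using assms unfolding ultrafilter_on_nat_def by blast

lemma ultrafilter_mono2:
  assumes "ultrafilter_on_nat D" "X \<in> D" "Y \<in> D" "\<And>t. t \<in> X \<Longrightarrow> t \<in> Y \<Longrightarrow> t \<in> Z"
  shows "Z \<in> D"
  by (rule ultrafilter_mono[OF assms(1) ultrafilter_Int[OF assms(1-3)]]) (use assms(4) in auto)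

lemma ultrafilter_ex:
  assumes "ultrafilter_on_nat D" "X \<in> D"
  shows "\<exists>t. t \<in> X"
  using assms unfolding ultrafilter_on_nat_def by (metis all_not_in_conv)

lemma ultrafilter_Un:
  assumes D: "ultrafilter_on_nat D" and "X \<union> Y \<in> D"
  shows "X \<in> D \<or> Y \<in> D"
proof (rule disjCI)
  assume "Y \<notin> D"
  then have "- Y \<in> D" using D unfolding ultrafilter_on_nat_def by blast
  then show "X \<in> D" by (rule ultrafilter_mono2[OF assms]) auto
qed

lemma ultrafilter_finite_UN:
  assumes D: "ultrafilter_on_nat D" and "finite I" "(\<Union>i\<in>I. X i) \<in> D"
  shows "\<exists>i\<in>I. X i \<in> D"
  using assms(2,3)
proof (induction I)
  case empty
  then show ?case using D unfolding ultrafilter_on_nat_def by simp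
next
  case (insert i I)
  then show ?case using ultrafilter_Un[OF D, of "X i" "\<Union>i\<in>I. X i"] by auto
qed

lemma ultrafilter_finite_INT:
  assumes D: "ultrafilter_on_nat D" and "finite I" "\<And>i. i \<in> I \<Longrightarrow> X i \<in> D"
  shows "(\<Inter>i\<in>I. X i) \<in> D"
  using assms(2,3)
proof (induction I)
  case empty
  then show ?case using D unfolding ultrafilter_on_nat_def by simp
next
  case (insert i I)
  then show ?case using ultrafilter_Int[OF D, of "X i" "\<Inter>i\<in>I. X i"] by auto
qed

lemma nonprincipal_greaterThan:
  assumes D: "ultrafilter_on_nat D" and "nonprincipal D"
  shows "{n<..} \<in> D"
proof -
  have "{..n} \<notin> D" using assms(2) unfolding nonprincipal_def by auto
  then have "- {..n} \<in> D" using D unfolding ultrafilter_on_nat_def by blast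
  then show ?thesis by (rule ultrafilter_mono[OF D]) auto
qed

text \<open>A diagonal choice: at index \<open>t\<close> let \<open>x t\<close> satisfy as long an
  initial run of the conditions as possible, up to length \<open>t\<close>. For fixed
  \<open>i\<close> this run includes \<open>i\<close> whenever \<open>t > i\<close> and the first
  \<open>i + 1\<close> conditions are jointly satisfiable at \<open>t\<close>, hence for D-many
  \<open>t\<close>.\<close>

lemma countable_saturation_nat:
  fixes \<phi> :: "nat \<Rightarrow> nat \<Rightarrow> 'm \<Rightarrow> bool"
  assumes D: "ultrafilter_on_nat D" "nonprincipal D"
    and sat: "\<And>n. {t. \<exists>x. \<forall>i<n. \<phi> i t x} \<in> D"
  shows "\<exists>x. \<forall>i. {t. \<phi> i t (x t)} \<in> D"
proof -
  \<comment> \<open>The cap \<open>n \<le> t\<close> ensures that the greatest \<open>n\<close>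
    exists even at indices where arbitrarily long runs are satisfiable; nonprincipality makes the
    cap harmless.\<close>
  define P where "P t n \<longleftrightarrow> n \<le> t \<and> (\<exists>x. \<forall>i<n. \<phi> i t x)" for t n
  define m where "m t = (GREATEST n. P t n)" for t
  have P0: "P t 0" for t unfolding P_def by simp
  have bd: "P t n \<Longrightarrow> n \<le> t" for t n unfolding P_def by simp
  have Pm: "P t (m t)" for t unfolding m_def by (rule GreatestI_nat[of "P t", OF P0 bd])
  have mle: "P t n \<Longrightarrow> n \<le> m t" for t n unfolding m_def by (rule Greatest_le_nat[of "P t" _ t, OF _ bd])
  from Pm have "\<forall>t. \<exists>x. \<forall>i<m t. \<phi> i t x" unfolding P_def by blast
  then obtain x where x: "\<And>t i. i < m t \<Longrightarrow> \<phi> i t (x t)" by metis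
  have "{t. \<phi> i t (x t)} \<in> D" for i
  proof (rule ultrafilter_mono2[OF D(1) nonprincipal_greaterThan[OF D, of i] sat[of "Suc i"]])
    fix t assume "t \<in> {i<..}" "t \<in> {t. \<exists>x. \<forall>j<Suc i. \<phi> j t x}"
    then have "P t (Suc i)" unfolding P_def by auto
    then have "i < m t" using mle by fastforce
    then show "t \<in> {t. \<phi> i t (x t)}" using x by simp
  qed
  then show ?thesis by blast
qed

lemma countable_saturation:
  fixes \<phi> :: "'i \<Rightarrow> nat \<Rightarrow> 'm \<Rightarrow> bool"
  assumes D: "ultrafilter_on_nat D" "nonprincipal D" and "countable I"
    and sat: "\<And>J. finite J \<Longrightarrow> J \<subseteq> I \<Longrightarrow> {t. \<exists>x. \<forall>i\<in>J. \<phi> i t x} \<in> D"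
  shows "\<exists>x. \<forall>i\<in>I. {t. \<phi> i t (x t)} \<in> D"
proof (cases "I = {}")
  case False
  have "\<exists>x. \<forall>n. {t. \<phi> (from_nat_into I n) t (x t)} \<in> D"
  proof (rule countable_saturation_nat[OF D])
    fix n
    have "{t. \<exists>x. \<forall>i\<in>from_nat_into I ` {..<n}. \<phi> i t x} \<in> D"
      by (rule sat) (use from_nat_into[OF False] in auto)
    then show "{t. \<exists>x. \<forall>i<n. \<phi> (from_nat_into I i) t x} \<in> D"
      by (rule ultrafilter_mono[OF D(1)]) auto
  qed
  then show ?thesis
    using range_from_nat_into[OF False \<open>countable I\<close>] by (metis imageE)
qed simp

section \<open>Embeddings of induced substructures\<close>

lemma carr_induced [simp]: "carr (induced S X) = X"
  by (simp add: induced_def)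

lemma rels_induced [simp]: "rels (induced S X) R xs \<longleftrightarrow> rels S R xs \<and> set xs \<subseteq> X"
  by (simp add: induced_def)

lemma induced_induced [simp]: "X \<subseteq> Y \<Longrightarrow> induced (induced S Y) X = induced S X"
  by (auto simp: induced_def fun_eq_iff)

lemma embedding_comp:
  assumes "embedding L ar A B g" "embedding L ar B C h"
  shows "embedding L ar A C (h \<circ> g)"
  unfolding embedding_def
proof (intro conjI)
  show "inj_on (h \<circ> g) (carr A)"
    using assms unfolding embedding_def by (meson comp_inj_on inj_on_subset)
  show "(h \<circ> g) ` carr A \<subseteq> carr C"
    using assms unfolding embedding_def by fastforce
  show "preserves L ar A C (h \<circ> g)"
    unfolding preserves_def
  proof (intro ballI allI impI)
    fix R xs assume R: "R \<in> L" and xs: "length xs = ar R \<and> set xs \<subseteq> carr A"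
    have "rels A R xs \<longleftrightarrow> rels B R (map g xs)"
      using assms(1) R xs unfolding embedding_def preserves_def by blast
    also have "length (map g xs) = ar R \<and> set (map g xs) \<subseteq> carr B"
      using assms(1) xs unfolding embedding_def by auto
    then have "rels B R (map g xs) \<longleftrightarrow> rels C R (map h (map g xs))"
      using assms(2) R unfolding embedding_def preserves_def by blast
    finally show "rels A R xs \<longleftrightarrow> rels C R (map (h \<circ> g) xs)" by simp
  qed
qed

lemma embedding_cong:
  assumes "embedding L ar A B g" "\<And>x. x \<in> carr A \<Longrightarrow> g x = h x"
  shows "embedding L ar A B h"
proof -
  have m: "map h xs = map g xs" if "set xs \<subseteq> carr A" for xs
    using assms(2) that by auto
  have "preserves L ar A B h"
    using assms(1) m unfolding embedding_def preserves_def by metis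
  moreover have "g ` carr A = h ` carr A" using assms(2) by (auto intro: image_cong)
  moreover have "inj_on g (carr A) = inj_on h (carr A)" using assms(2) by (rule inj_on_cong)
  ultimately show ?thesis using assms(1) unfolding embedding_def by simp
qed

lemma embedding_induced_mono:
  assumes "embedding L ar (induced S Y) T h" "X \<subseteq> Y"
  shows "embedding L ar (induced S X) T h"
  using assms unfolding embedding_def preserves_def
  by (auto intro: inj_on_subset)

lemma embedding_induced_subset:
  assumes "embedding L ar S T h" "X \<subseteq> carr S"
  shows "embedding L ar (induced S X) T h"
  using assms unfolding embedding_def preserves_def
  by (auto intro: inj_on_subset)

lemma embedding_inclusion: "X \<subseteq> carr S \<Longrightarrow> embedding L ar (induced S X) S id"
  unfolding embedding_def preserves_def by auto

lemma isomorphic_iff_embedding: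
  "isomorphic L ar A B \<longleftrightarrow> (\<exists>h. embedding L ar A B h \<and> h ` carr A = carr B)"
  unfolding isomorphic_def embedding_def bij_betw_def by auto

lemma isomorphic_trans:
  assumes "isomorphic L ar A B" "isomorphic L ar B C"
  shows "isomorphic L ar A C"
proof -
  obtain g h where "embedding L ar A B g" "g ` carr A = carr B"
    "embedding L ar B C h" "h ` carr B = carr C"
    using assms unfolding isomorphic_iff_embedding by blast
  then have "embedding L ar A C (h \<circ> g)" "(h \<circ> g) ` carr A = carr C"
    by (simp_all only: embedding_comp image_comp[symmetric])
  then show ?thesis unfolding isomorphic_iff_embedding by blast
qed

lemma isomorphic_sym:
  assumes "isomorphic L ar A B"
  shows "isomorphic L ar B A"
proof -
  obtain h where h: "bij_betw h (carr A) (carr B)" "preserves L ar A B h"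
    using assms unfolding isomorphic_def by blast
  let ?g = "inv_into (carr A) h"
  have "preserves L ar B A ?g"
    unfolding preserves_def
  proof (intro ballI allI impI)
    fix R xs assume R: "R \<in> L" and xs: "length xs = ar R \<and> set xs \<subseteq> carr B"
    have "set (map ?g xs) \<subseteq> carr A"
      using xs bij_betw_inv_into[OF h(1)] by (auto simp: bij_betw_def)
    then have "rels A R (map ?g xs) \<longleftrightarrow> rels B R (map h (map ?g xs))"
      using h(2) R xs unfolding preserves_def by simp
    moreover have "map h (map ?g xs) = xs"
      unfolding map_map using xs h(1) by (intro map_idI) (auto simp: bij_betw_inv_into_right)
    ultimately show "rels B R xs \<longleftrightarrow> rels A R (map ?g xs)" by simp
  qed
  then show ?thesis
    unfolding isomorphic_def using bij_betw_inv_into[OF h(1)] by blast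
qed

lemma embedding_induced_codomain:
  assumes "embedding L ar A B h" "h ` carr A \<subseteq> Y"
  shows "embedding L ar A (induced B Y) h"
proof -
  have "set (map h xs) \<subseteq> Y" if "set xs \<subseteq> carr A" for xs
    using assms(2) that by auto
  then show ?thesis using assms unfolding embedding_def preserves_def by simp
qed

lemma isomorphic_embedding_image:
  assumes "embedding L ar A B h"
  shows "isomorphic L ar A (induced B (h ` carr A))"
  unfolding isomorphic_iff_embedding
  using embedding_induced_codomain[OF assms order.refl] by (metis carr_induced)

text \<open>\<open>e\<close> restricts to an isomorphism from \<open>X\<close> onto its image. This
  is what allows colourings of copies in \<open>T\<close> to be pulled back to
  \<open>C\<close>.\<close>

lemma copies_embedding_image:
  assumes e: "embedding L ar C T e" and X: "X \<subseteq> carr C"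
  shows "e ` X \<in> copies L ar T A \<longleftrightarrow> X \<in> copies L ar C A"
proof -
  have iso: "isomorphic L ar (induced C X) (induced T (e ` X))"
    using isomorphic_embedding_image[OF embedding_induced_subset[OF e X]] by simp
  have "e ` X \<subseteq> carr T" using e X unfolding embedding_def by blast
  then show ?thesis
    unfolding copies_def using X iso by (auto intro: isomorphic_trans isomorphic_sym)
qed

lemma copies_induced:
  assumes "Y \<subseteq> carr S"
  shows "copies L ar (induced S Y) A = {X \<in> copies L ar S A. X \<subseteq> Y}"
  using assms unfolding copies_def by auto

text \<open>Members of the age live on \<open>nat\<close>, so \<open>F\<close> is numbered by an
  injection and its relations are transported along it.\<close>

lemma age_member_isomorphic_induced:
  assumes N: "is_struc L ar N" and F: "finite F" "F \<subseteq> carr N"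
  shows "\<exists>B\<in>age L ar N. isomorphic L ar (induced N F) B"
proof -
  obtain g :: "_ \<Rightarrow> nat" where g: "inj_on g F"
    using F(1) finite_imp_inj_to_nat_seg by meson
  define B where "B = \<lparr>carr = g ` F,
     rels = (\<lambda>R ys. \<exists>xs. set xs \<subseteq> F \<and> ys = map g xs \<and> rels N R xs)\<rparr>"
  have B: "is_struc L ar B" "finite (carr B)"
    using N F unfolding is_struc_def B_def by fastforce+
  have "rels N R xs \<longleftrightarrow> rels B R (map g xs)" if "set xs \<subseteq> F" for R xs
  proof
    assume "rels B R (map g xs)"
    then obtain ys where "set ys \<subseteq> F" "map g xs = map g ys" "rels N R ys"
      unfolding B_def by auto
    moreover from this have "xs = ys"
      using that inj_on_subset[OF g] inj_on_map_eq_map by (metis Un_least)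
    ultimately show "rels N R xs" by simp
  qed (use that in \<open>auto simp: B_def\<close>)
  then have "preserves L ar (induced N F) B g"
    unfolding preserves_def by simp
  then have iso: "isomorphic L ar (induced N F) B"
    unfolding isomorphic_def using g by (auto simp: B_def bij_betw_def)
  from isomorphic_sym[OF this] obtain h where "embedding L ar B (induced N F) h"
    unfolding isomorphic_iff_embedding by blast
  from embedding_comp[OF this embedding_inclusion[OF F(2)]]
  have "B \<in> age L ar N" using B unfolding age_def embeds_def by blast
  with iso show ?thesis by blast
qed

section \<open>Isomorphism types of finite sets over a countable set\<close>

text \<open>The atomic diagram of a list, written in positions instead of elements, with entries
  from \<open>C\<close> kept by name. Relations to points of \<open>C\<close> outside the list are
  left out on purpose: full types over a countable \<open>C\<close> can be uncountable in
  number.\<close>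

definition type_code :: "'r set \<Rightarrow> ('r \<Rightarrow> nat) \<Rightarrow> ('n, 'r) struc \<Rightarrow> 'n set \<Rightarrow> 'n list
    \<Rightarrow> 'n option list \<times> ('r \<times> nat list) set" where
  "type_code L ar N C us =
     (map (\<lambda>u. if u \<in> C then Some u else None) us,
      {(R, is). R \<in> L \<and> length is = ar R \<and> set is \<subseteq> {..<length us} \<and> rels N R (map ((!) us) is)})"

text \<open>Finitely many symbols and positions leave only finitely many atomic facts about each
  list, so a code is a list over a countable set paired with a finite subset of a countable
  set.\<close>

lemma countable_type_codes:
  assumes "finite L" "countable C"
  shows "countable (range (type_code L ar N C))"
proof -
  have "finite (snd (type_code L ar N C us))" for us
  proof (rule finite_subset)
    show "snd (type_code L ar N C us) \<subseteq>
        (\<Union>R\<in>L. {R} \<times> {is. set is \<subseteq> {..<length us} \<and> length is = ar R})"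
      unfolding type_code_def by auto
    show "finite (\<Union>R\<in>L. {R} \<times> {is. set is \<subseteq> {..<length us} \<and> length is = ar R})"
      using assms(1) by (intro finite_UN_I finite_cartesian_product finite_lists_length_eq) auto
  qed
  then have "range (type_code L ar N C) \<subseteq> lists (insert None (Some ` C)) \<times> Fpow (L \<times> UNIV)"
    unfolding Fpow_def type_code_def by auto
  moreover have "countable (lists (insert None (Some ` C)) \<times> Fpow (L \<times> (UNIV :: nat list set)))"
    using assms
    by (intro countable_SIGMA countable_lists countable_Fpow countable_insert countable_image)
      (auto intro: countable_finite)
  ultimately show ?thesis by (rule countable_subset)
qed

text \<open>Entries are matched by position: the second components give the relations, the first fix
  the points of \<open>C\<close>, and distinctness gives injectivity.\<close>

lemma type_code_eq_imp_embedding: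
  assumes "distinct us" "distinct vs" and eq: "type_code L ar N C us = type_code L ar N C vs"
  shows "\<exists>h. embedding L ar (induced N (set us)) (induced N (set vs)) h \<and> (\<forall>u\<in>set us \<inter> C. h u = u)"
proof -
  have m: "map (\<lambda>u. if u \<in> C then Some u else None) us = map (\<lambda>u. if u \<in> C then Some u else None) vs"
    using eq by (simp add: type_code_def)
  have len: "length us = length vs" using m by (rule map_eq_imp_length_eq)
  define ix where "ix u = (SOME i. i < length us \<and> us ! i = u)" for u
  have ix: "ix u < length us" "us ! ix u = u" if "u \<in> set us" for u
    using someI_ex[of "\<lambda>i. i < length us \<and> us ! i = u"] that
    unfolding ix_def in_set_conv_nth by blast+
  define h where "h u = vs ! ix u" for u
  have fixC: "h u = u" if "u \<in> set us \<inter> C" for u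
  proof -
    have "map (\<lambda>u. if u \<in> C then Some u else None) us ! ix u
        = map (\<lambda>u. if u \<in> C then Some u else None) vs ! ix u" by (simp only: m)
    then show ?thesis using that ix[of u] len by (simp add: h_def split: if_splits)
  qed
  have inj: "inj_on h (set us)"
  proof (rule inj_onI)
    fix u v assume uv: "u \<in> set us" "v \<in> set us" and "h u = h v"
    then have "ix u = ix v"
      using nth_eq_iff_index_eq[OF assms(2)] ix(1) len by (simp add: h_def)
    then show "u = v" using ix(2) uv by metis
  qed
  have im: "h ` set us \<subseteq> set vs" using ix(1) len by (auto simp: h_def)
  have "rels N R xs \<longleftrightarrow> rels N R (map h xs)"
    if R: "R \<in> L" "length xs = ar R" and xs: "set xs \<subseteq> set us" for R xs
  proof -
    have 1: "set (map ix xs) \<subseteq> {..<length us}" using ix(1) xs by auto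
    have 2: "map ((!) us) (map ix xs) = xs"
      unfolding map_map using ix(2) xs by (intro map_idI) auto
    have 3: "map ((!) vs) (map ix xs) = map h xs" by (simp add: h_def)
    have "(R, map ix xs) \<in> snd (type_code L ar N C us) \<longleftrightarrow> (R, map ix xs) \<in> snd (type_code L ar N C vs)"
      by (simp only: eq)
    then show ?thesis
      unfolding type_code_def snd_conv mem_Collect_eq prod.case 2 3 using R 1 len by simp
  qed
  moreover have "set (map h xs) \<subseteq> set vs" if "set xs \<subseteq> set us" for xs
    using im that by auto
  ultimately have "embedding L ar (induced N (set us)) (induced N (set vs)) h"
    using inj im unfolding embedding_def preserves_def by simp
  with fixC show ?thesis by blast
qed

text \<open>Replaces possibly uncountably many finite sets by countably many, so that countable
  saturation can deal with all of them.\<close>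

lemma countable_representatives_over:
  assumes "finite L" "countable C"
  shows "\<exists>\<F>. countable \<F> \<and> (\<forall>F\<in>\<F>. finite F \<and> F \<subseteq> carr N) \<and>
     (\<forall>F. finite F \<longrightarrow> F \<subseteq> carr N \<longrightarrow>
       (\<exists>F'\<in>\<F>. \<exists>h. embedding L ar (induced N F) (induced N F') h \<and> (\<forall>u\<in>F \<inter> C. h u = u)))"
proof -
  let ?code = "type_code L ar N C"
  define U where "U = {us. distinct us \<and> set us \<subseteq> carr N}"
  \<comment> \<open>One list is kept per realised code. A finite set is later listed in an arbitrary
    order and represented by the kept list with the same code.\<close>
  define \<F> where "\<F> = (\<lambda>p. set (inv_into U ?code p)) ` ?code ` U"
  have "countable (?code ` U)"
    by (rule countable_subset[OF _ countable_type_codes[OF assms]]) auto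
  then have "countable \<F>" unfolding \<F>_def by (rule countable_image)
  moreover have "finite F \<and> F \<subseteq> carr N" if F: "F \<in> \<F>" for F
  proof -
    obtain us where "us \<in> U" "F = set (inv_into U ?code (?code us))"
      using F unfolding \<F>_def by blast
    then show ?thesis using inv_into_into[of "?code us" ?code U] by (auto simp: U_def)
  qed
  moreover have "\<exists>F'\<in>\<F>. \<exists>h. embedding L ar (induced N F) (induced N F') h \<and> (\<forall>u\<in>F \<inter> C. h u = u)"
    if F: "finite F" "F \<subseteq> carr N" for F
  proof -
    obtain us where us: "set us = F" "distinct us" using finite_distinct_list[OF F(1)] by blast
    then have U: "us \<in> U" using F by (simp add: U_def)
    let ?vs = "inv_into U ?code (?code us)"
    have vs: "?vs \<in> U" "?code ?vs = ?code us"
      using U by (auto intro: inv_into_into f_inv_into_f)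
    have "set ?vs \<in> \<F>" using U unfolding \<F>_def by blast
    moreover have "\<exists>h. embedding L ar (induced N F) (induced N (set ?vs)) h \<and> (\<forall>u\<in>F \<inter> C. h u = u)"
      using type_code_eq_imp_embedding[OF us(2) _ vs(2)[symmetric]] vs(1) us(1) by (simp add: U_def)
    ultimately show ?thesis by blast
  qed
  ultimately show ?thesis by blast
qed

section \<open>Transfinite construction of an embedding\<close>

text \<open>\<open>card_of X\<close> is a well-order of least possible type, so its proper initial
  segments are smaller than \<open>X\<close>, hence smaller than aleph_1.\<close>

lemma underS_card_of_countable:
  assumes "card_le_aleph1 X" "a \<in> X"
  shows "countable (underS (card_of X) a)"
proof -
  have "(card_of (underS (card_of X) a), card_of X) \<in> ordLess"
    using card_of_underS[OF card_of_Card_order[of X], of a] assms(2) by (simp add: Field_card_of)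
  then have "(card_of (underS (card_of X) a), cardSuc natLeq) \<in> ordLess"
    using assms(1) unfolding card_le_aleph1_def by (rule ordLess_ordLeq_trans)
  then show ?thesis
    using cardSuc_ordLeq_ordLess[OF natLeq_Card_order card_of_Card_order]
    unfolding countable_card_le_natLeq by blast
qed

text \<open>The invariant of the recursion: \<open>C\<close> holds the points already placed, and
  \<open>f u\<close> is a representing function for the image of \<open>u\<close>. The witness
  \<open>h\<close> may vary with \<open>t\<close> and must also place the rest of \<open>F\<close>,
  which leaves room for later points.\<close>

definition extends_often :: "'r set \<Rightarrow> ('r \<Rightarrow> nat) \<Rightarrow> nat set set \<Rightarrow> (nat \<Rightarrow> ('m, 'r) struc)
    \<Rightarrow> (nat \<Rightarrow> 'm set \<Rightarrow> bool) \<Rightarrow> ('n, 'r) struc \<Rightarrow> 'n set \<Rightarrow> 'n set \<Rightarrow> ('n \<Rightarrow> nat \<Rightarrow> 'm) \<Rightarrow> bool" where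
  "extends_often L ar D M good N F C f \<longleftrightarrow>
     {t. \<exists>h. embedding L ar (induced N F) (M t) h \<and> (\<forall>u\<in>F \<inter> C. h u = f u t) \<and> good t (h ` F)} \<in> D"

text \<open>The value at \<open>a\<close> must meet one condition per representative, and saturation
  meets them all. Finitely many conditions are solved together by the invariant for the union of
  their sets; any other finite set inherits its condition by composition with an embedding into a
  representative.\<close>

lemma extends_often_step:
  assumes L: "finite L" and D: "ultrafilter_on_nat D" "nonprincipal D"
    and anti: "\<And>t X Y. good t Y \<Longrightarrow> X \<subseteq> Y \<Longrightarrow> good t X"
    and C: "countable C" and a: "a \<in> carr N" "a \<notin> C"
    and ext: "\<And>F. finite F \<Longrightarrow> F \<subseteq> carr N \<Longrightarrow> extends_often L ar D M good N F C f"
  shows "\<exists>x. \<forall>F. finite F \<longrightarrow> F \<subseteq> carr N \<longrightarrow>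
           extends_often L ar D M good N F (insert a C) (f(a := x))"
proof -
  \<comment> \<open>Representatives over \<open>insert a C\<close> make the connecting embeddings
    fix \<open>a\<close> as well as the placed points.\<close>
  obtain \<F> where \<F>: "countable \<F>" "\<forall>F\<in>\<F>. finite F \<and> F \<subseteq> carr N"
    "\<forall>F. finite F \<longrightarrow> F \<subseteq> carr N \<longrightarrow> (\<exists>F'\<in>\<F>. \<exists>h. embedding L ar (induced N F) (induced N F') h
        \<and> (\<forall>u\<in>F \<inter> insert a C. h u = u))"
    using countable_representatives_over[OF L countable_insert[OF C, of a], where N = N and ar = ar]
    by (elim exE conjE) (rule that)
  define \<phi> where "\<phi> F t x \<longleftrightarrow> (\<exists>h. embedding L ar (induced N F) (M t) h
      \<and> (\<forall>u\<in>F \<inter> insert a C. h u = (if u = a then x else f u t)) \<and> good t (h ` F))" for F t x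
  have "\<exists>x. \<forall>F\<in>\<F>. {t. \<phi> F t (x t)} \<in> D"
  proof (rule countable_saturation[OF D \<F>(1)])
    fix J assume J: "finite J" "J \<subseteq> \<F>"
    let ?F = "insert a (\<Union>J)"
    have "finite ?F" "?F \<subseteq> carr N" using J \<F>(2) a by auto
    from ext[OF this]
    show "{t. \<exists>x. \<forall>F\<in>J. \<phi> F t x} \<in> D"
      unfolding extends_often_def
    proof (rule ultrafilter_mono[OF D(1)])
      fix t
      assume "t \<in> {t. \<exists>h. embedding L ar (induced N ?F) (M t) h \<and> (\<forall>u\<in>?F \<inter> C. h u = f u t) \<and> good t (h ` ?F)}"
      then obtain h where h: "embedding L ar (induced N ?F) (M t) h"
        "\<And>u. u \<in> ?F \<inter> C \<Longrightarrow> h u = f u t" "good t (h ` ?F)" by blast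
      \<comment> \<open>The value at \<open>a\<close> of one embedding of the whole union is the
        common solution.\<close>
      have "\<phi> F t (h a)" if "F \<in> J" for F
      proof -
        have FF: "F \<subseteq> ?F" using that by blast
        have "embedding L ar (induced N F) (M t) h" using h(1) FF by (rule embedding_induced_mono)
        moreover have "good t (h ` F)" by (rule anti[OF h(3) image_mono[OF FF]])
        moreover have "\<forall>u\<in>F \<inter> insert a C. h u = (if u = a then h a else f u t)"
        proof
          fix u assume "u \<in> F \<inter> insert a C"
          then show "h u = (if u = a then h a else f u t)"
            using h(2)[of u] FF by (cases "u = a") auto
        qed
        ultimately show ?thesis unfolding \<phi>_def by blast
      qed
      then show "t \<in> {t. \<exists>x. \<forall>F\<in>J. \<phi> F t x}" by blast
    qed
  qed
  then obtain x where x: "\<And>F. F \<in> \<F> \<Longrightarrow> {t. \<phi> F t (x t)} \<in> D" by blast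
  have "extends_often L ar D M good N F (insert a C) (f(a := x))" if F: "finite F" "F \<subseteq> carr N" for F
  proof -
    have "\<exists>F'\<in>\<F>. \<exists>h. embedding L ar (induced N F) (induced N F') h
        \<and> (\<forall>u\<in>F \<inter> insert a C. h u = u)" using \<F>(3)[rule_format, OF F] .
    then obtain F' g where F': "F' \<in> \<F>" and g: "embedding L ar (induced N F) (induced N F') g"
      "\<forall>u\<in>F \<inter> insert a C. g u = u" by (elim bexE exE conjE) (rule that)
    have gF: "g ` F \<subseteq> F'" using g(1) unfolding embedding_def by simp
    show ?thesis
      unfolding extends_often_def
    proof (rule ultrafilter_mono[OF D(1) x[OF F']])
      fix t assume "t \<in> {t. \<phi> F' t (x t)}"
      then obtain h where h: "embedding L ar (induced N F') (M t) h"
        "\<And>u. u \<in> F' \<inter> insert a C \<Longrightarrow> h u = (if u = a then x t else f u t)" "good t (h ` F')"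
        unfolding \<phi>_def by blast
      have "embedding L ar (induced N F) (M t) (h \<circ> g)" using g(1) h(1) by (rule embedding_comp)
      moreover have "good t ((h \<circ> g) ` F)"
        unfolding image_comp[symmetric] by (rule anti[OF h(3) image_mono[OF gF]])
      moreover have "(h \<circ> g) u = (f(a := x)) u t" if "u \<in> F \<inter> insert a C" for u
      proof -
        have gu: "g u = u" using g(2) that by blast
        then have "u \<in> F'" using gF that by force
        then show ?thesis using gu h(2)[of u] that by simp
      qed
      ultimately show "t \<in> {t. \<exists>h. embedding L ar (induced N F) (M t) h
          \<and> (\<forall>u\<in>F \<inter> insert a C. h u = (f(a := x)) u t) \<and> good t (h ` F)}" by blast
    qed
  qed
  then show ?thesis by blast
qed

lemma extends_often_cong:
  assumes "extends_often L ar D M good N F C f" "F \<inter> C = F \<inter> C'" "\<And>u. u \<in> F \<inter> C \<Longrightarrow> f u = g u"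
  shows "extends_often L ar D M good N F C' g"
proof -
  have "(\<forall>u\<in>F \<inter> C. h u = f u t) \<longleftrightarrow> (\<forall>u\<in>F \<inter> C'. h u = g u t)" for h t
    using assms(2,3) by auto
  then show ?thesis using assms(1) unfolding extends_often_def by simp
qed

lemma extends_often_mono:
  assumes "ultrafilter_on_nat D" "extends_often L ar D M good N F C f" "F \<inter> C' \<subseteq> C"
  shows "extends_often L ar D M good N F C' f"
  using assms(2) unfolding extends_often_def
  by (rule ultrafilter_mono[OF assms(1)]) (use assms(3) in blast)

text \<open>The recursion works with representing functions, before the ultraproduct is formed.
  Keeping \<open>good\<close> abstract isolates what is needed of the colouring: heredity to
  subsets.\<close>

lemma ultraproduct_embedding_family:
  fixes N :: "('n, 'r) struc" and M :: "nat \<Rightarrow> ('m, 'r) struc"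
  assumes L: "finite L" and D: "ultrafilter_on_nat D" "nonprincipal D"
    and anti: "\<And>t X Y. good t Y \<Longrightarrow> X \<subseteq> Y \<Longrightarrow> good t X"
    and N: "card_le_aleph1 (carr N)"
    and ext: "\<And>F. finite F \<Longrightarrow> F \<subseteq> carr N \<Longrightarrow>
       {t. \<exists>h. embedding L ar (induced N F) (M t) h \<and> good t (h ` F)} \<in> D"
  shows "\<exists>f. \<forall>F. finite F \<longrightarrow> F \<subseteq> carr N \<longrightarrow>
       {t. embedding L ar (induced N F) (M t) (\<lambda>u. f u t) \<and> good t ((\<lambda>u. f u t) ` F)} \<in> D"
proof -
  let ?E = "\<lambda>F C f. extends_often L ar D M good N F C f"
  define r where "r = card_of (carr N)"
  have wo: "well_order_on (carr N) r" unfolding r_def by (rule card_of_well_order_on)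
  have wf: "wf (r - Id)" using wo unfolding well_order_on_def by blast
  have lin: "linear_order_on (carr N) r" using wo unfolding well_order_on_def by blast
  \<comment> \<open>\<open>SOME\<close> picks an admissible value given the earlier ones; that one
    exists at every stage is part of the induction proving \<open>inv\<close>.\<close>
  define H where "H g a = (SOME x. \<forall>F. finite F \<longrightarrow> F \<subseteq> carr N \<longrightarrow>
      ?E F (insert a (underS r a)) (g(a := x)))" for g a
  define f where "f = wfrec (r - Id) H"
  have feq: "f a = H (cut f (r - Id) a) a" for a
    unfolding f_def by (rule wfrec[OF wf])
  have cut: "cut f (r - Id) a u = f u" if "u \<in> underS r a" for a u
    using that by (simp add: cut_def underS_def)
  have base: "?E F {} g" if "finite F" "F \<subseteq> carr N" for F g
    using ext[OF that] unfolding extends_often_def by simp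
  \<comment> \<open>A finite set meets an initial segment in a set with a greatest element,
    so the invariant passes to limit stages.\<close>
  have limit: "?E F C f"
    if step: "\<And>b F. b \<in> C \<Longrightarrow> finite F \<Longrightarrow> F \<subseteq> carr N \<Longrightarrow> ?E F (insert b (underS r b)) f"
      and F: "finite F" "F \<subseteq> carr N" for F C
  proof (cases "F \<inter> C = {}")
    case True
    then show ?thesis using extends_often_mono[OF D(1) base[OF F]] by simp
  next
    case False
    have "\<exists>b\<in>F \<inter> C. \<forall>u\<in>F \<inter> C. (u, b) \<in> r"
    proof -
      have "finite G \<Longrightarrow> G \<noteq> {} \<Longrightarrow> G \<subseteq> carr N \<Longrightarrow> \<exists>b\<in>G. \<forall>u\<in>G. (u, b) \<in> r" for G
      proof (induction G rule: finite_ne_induct)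
        case (singleton x)
        then show ?case using lin
          by (auto simp: linear_order_on_def partial_order_on_def preorder_on_def refl_on_def)
      next
        case (insert x G)
        then obtain b where b: "b \<in> G" "\<forall>u\<in>G. (u, b) \<in> r" by auto
        have refl: "(x, x) \<in> r" and tr: "trans r" and total: "total_on (carr N) r"
          using lin insert.prems
          by (auto simp: linear_order_on_def partial_order_on_def preorder_on_def refl_on_def)
        have tot: "(x, b) \<in> r \<or> (b, x) \<in> r"
          using refl total insert.prems b(1) unfolding total_on_def by (cases "x = b") auto
        show ?case
        proof (cases "(x, b) \<in> r")
          case True
          then show ?thesis using b by blast
        next
          case False
          then have "(b, x) \<in> r" using tot by blast
          then have "\<forall>u\<in>G. (u, x) \<in> r" using b(2) tr by (meson transD)
          then show ?thesis using refl by blast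
        qed
      qed
      from this[of "F \<inter> C"] show ?thesis using F False by blast
    qed
    then obtain b where b: "b \<in> F \<inter> C" "\<And>u. u \<in> F \<inter> C \<Longrightarrow> (u, b) \<in> r" by blast
    have "?E F (insert b (underS r b)) f" using step b(1) F by blast
    then show ?thesis
      by (rule extends_often_mono[OF D(1)]) (use b(2) in \<open>auto simp: underS_def\<close>)
  qed
  have inv: "\<forall>F. finite F \<longrightarrow> F \<subseteq> carr N \<longrightarrow> ?E F (insert a (underS r a)) f" if "a \<in> carr N" for a
    using that
  proof (induction a rule: wf_induct_rule[OF wf])
    case (1 a)
    let ?g = "cut f (r - Id) a"
    have a: "a \<notin> underS r a" by (simp add: underS_def)
    have below: "b \<in> carr N \<and> (b, a) \<in> r - Id" if "b \<in> underS r a" for b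
      using that lin
      by (auto simp: underS_def linear_order_on_def partial_order_on_def preorder_on_def refl_on_def)
    have "?E F (underS r a) f" if "finite F" "F \<subseteq> carr N" for F
      by (rule limit[OF _ that]) (use 1 below in blast)
    \<comment> \<open>The recursion sees only the restriction \<open>cut\<close> of
      \<open>f\<close>, which agrees with \<open>f\<close> below \<open>a\<close>.\<close>
    then have "?E F (underS r a) ?g" if "finite F" "F \<subseteq> carr N" for F
      by (rule extends_often_cong) (use that cut in auto)
    moreover have "countable (underS r a)"
      unfolding r_def using N 1(2) by (rule underS_card_of_countable)
    ultimately have "\<exists>x. \<forall>F. finite F \<longrightarrow> F \<subseteq> carr N \<longrightarrow>
        ?E F (insert a (underS r a)) (?g(a := x))"
      using 1(2) a by (intro extends_often_step[OF L D anti])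
    then have "\<forall>F. finite F \<longrightarrow> F \<subseteq> carr N \<longrightarrow>
        ?E F (insert a (underS r a)) (?g(a := H ?g a))"
      unfolding H_def by (rule someI_ex)
    \<comment> \<open>By the recursion equation the chosen value is \<open>f a\<close>, so the
      updated restriction agrees with \<open>f\<close> on
      \<open>insert a (underS r a)\<close>.\<close>
    then show ?case
      unfolding feq[symmetric] by (auto elim!: extends_often_cong simp: cut)
  qed
  have "{t. embedding L ar (induced N F) (M t) (\<lambda>u. f u t) \<and> good t ((\<lambda>u. f u t) ` F)} \<in> D"
    if F: "finite F" "F \<subseteq> carr N" for F
  proof -
    \<comment> \<open>Once all of \<open>N\<close> is placed, every value on \<open>F\<close> is
      prescribed, so the witness \<open>h\<close> coincides on \<open>F\<close> with
      \<open>f\<close> evaluated at \<open>t\<close>.\<close>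
    have "?E F (carr N) f" by (rule limit[OF _ F]) (use inv in blast)
    then show ?thesis
      unfolding extends_often_def
    proof (rule ultrafilter_mono[OF D(1)])
      fix t
      assume "t \<in> {t. \<exists>h. embedding L ar (induced N F) (M t) h \<and> (\<forall>u\<in>F \<inter> carr N. h u = f u t) \<and> good t (h ` F)}"
      then obtain h where h: "embedding L ar (induced N F) (M t) h"
        "\<And>u. u \<in> F \<Longrightarrow> h u = f u t" "good t (h ` F)" using F(2) by blast
      have "embedding L ar (induced N F) (M t) (\<lambda>u. f u t)"
        using h(1) by (rule embedding_cong) (simp add: h(2))
      moreover have "h ` F = (\<lambda>u. f u t) ` F" using h(2) by (auto intro: image_cong)
      ultimately show "t \<in> {t. embedding L ar (induced N F) (M t) (\<lambda>u. f u t) \<and> good t ((\<lambda>u. f u t) ` F)}"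
        using h(3) by simp
    qed
  qed
  then show ?thesis by blast
qed

section \<open>The ultraproduct\<close>

lemma uclass_refl: "ultrafilter_on_nat D \<Longrightarrow> f \<in> uclass D f"
  unfolding uclass_def ultrafilter_on_nat_def by simp

lemma rep_uclass:
  assumes "ultrafilter_on_nat D"
  shows "{t. rep (uclass D f) t = f t} \<in> D"
proof -
  have "rep (uclass D f) \<in> uclass D f"
    unfolding rep_def by (rule someI[of _ f]) (rule uclass_refl[OF assms])
  then show ?thesis by (simp add: uclass_def)
qed

text \<open>\<open>rep\<close> may return another member of a class, but for finitely many classes
  the agreement sets intersect in a member of \<open>D\<close>.\<close>

lemma rep_uclass_finite:
  assumes "ultrafilter_on_nat D" "finite F"
  shows "{t. \<forall>u\<in>F. rep (uclass D (f u)) t = f u t} \<in> D"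
  by (rule ultrafilter_mono[OF assms(1) ultrafilter_finite_INT[OF assms rep_uclass[OF assms(1)]]]) auto

text \<open>Only finitely many points matter at a time: pairs give injectivity, singletons
  membership in the carrier, and the entries of an argument list its relations.\<close>

lemma ultraproduct_embedding:
  assumes D: "ultrafilter_on_nat D"
    and f: "\<And>F. finite F \<Longrightarrow> F \<subseteq> carr N \<Longrightarrow>
       {t. embedding L ar (induced N F) (M t) (\<lambda>u. f u t)} \<in> D"
  shows "embedding L ar N (ultraproduct D M) (\<lambda>u. uclass D (f u))"
  unfolding embedding_def
proof (intro conjI)
  let ?\<phi> = "\<lambda>u. uclass D (f u)"
  have carrU: "carr (ultraproduct D M) = {uclass D f | f. {t. f t \<in> carr (M t)} \<in> D}"
    by (simp add: ultraproduct_def Let_def)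
  have relsU: "rels (ultraproduct D M) R as \<longleftrightarrow>
      set as \<subseteq> carr (ultraproduct D M) \<and> {t. rels (M t) R (map (\<lambda>a. rep a t) as)} \<in> D" for R as
    by (simp add: ultraproduct_def Let_def)
  show "inj_on ?\<phi> (carr N)"
  proof (rule inj_onI, rule ccontr)
    fix u v assume uv: "u \<in> carr N" "v \<in> carr N" "?\<phi> u = ?\<phi> v" "u \<noteq> v"
    have "{t. f u t = f v t} \<in> D"
      using uclass_refl[OF D, of "f u"] uv(3) unfolding uclass_def by simp
    moreover have "{t. embedding L ar (induced N {u, v}) (M t) (\<lambda>u. f u t)} \<in> D"
      using f[of "{u, v}"] uv by simp
    ultimately have "{} \<in> D"
      by (rule ultrafilter_mono2[OF D]) (use uv(4) in \<open>auto simp: embedding_def\<close>)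
    then show False using D unfolding ultrafilter_on_nat_def by simp
  qed
  show im: "?\<phi> ` carr N \<subseteq> carr (ultraproduct D M)"
  proof (rule image_subsetI)
    fix u assume "u \<in> carr N"
    then have "{t. embedding L ar (induced N {u}) (M t) (\<lambda>u. f u t)} \<in> D"
      using f[of "{u}"] by simp
    then have "{t. f u t \<in> carr (M t)} \<in> D"
      by (rule ultrafilter_mono[OF D]) (auto simp: embedding_def)
    then show "?\<phi> u \<in> carr (ultraproduct D M)" unfolding carrU by blast
  qed
  show "preserves L ar N (ultraproduct D M) ?\<phi>"
    unfolding preserves_def
  proof (intro ballI allI impI)
    fix R xs assume R: "R \<in> L" and xs: "length xs = ar R \<and> set xs \<subseteq> carr N"
    have E: "{t. embedding L ar (induced N (set xs)) (M t) (\<lambda>u. f u t)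
                \<and> (\<forall>u\<in>set xs. rep (?\<phi> u) t = f u t)} \<in> D"
      using f[of "set xs"] rep_uclass_finite[OF D, of "set xs" f] xs
      by (auto elim: ultrafilter_mono2[OF D])
    have key: "rels N R xs \<longleftrightarrow> rels (M t) R (map (\<lambda>a. rep a t) (map ?\<phi> xs))"
      if "embedding L ar (induced N (set xs)) (M t) (\<lambda>u. f u t)"
        "\<forall>u\<in>set xs. rep (?\<phi> u) t = f u t" for t
    proof -
      have eq: "map (\<lambda>a. rep a t) (map ?\<phi> xs) = map (\<lambda>u. f u t) xs"
        using that(2) by simp
      show ?thesis unfolding eq using that(1) R xs unfolding embedding_def preserves_def by auto
    qed
    have sub: "set (map ?\<phi> xs) \<subseteq> carr (ultraproduct D M)" using im xs by auto
    show "rels N R xs \<longleftrightarrow> rels (ultraproduct D M) R (map ?\<phi> xs)"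
    proof
      assume "rels N R xs"
      then have "{t. rels (M t) R (map (\<lambda>a. rep a t) (map ?\<phi> xs))} \<in> D"
        using key by (intro ultrafilter_mono[OF D E]) blast
      then show "rels (ultraproduct D M) R (map ?\<phi> xs)" using relsU sub by blast
    next
      assume "rels (ultraproduct D M) R (map ?\<phi> xs)"
      then have "{t. rels (M t) R (map (\<lambda>a. rep a t) (map ?\<phi> xs))} \<in> D" using relsU by blast
      \<comment> \<open>A single common index suffices, since \<open>rels N R xs\<close> does not
        depend on \<open>t\<close>.\<close>
      from ultrafilter_ex[OF D ultrafilter_Int[OF D E this]] show "rels N R xs" using key by blast
    qed
  qed
qed

section \<open>Choosing the colours\<close>

text \<open>The property used as \<open>good\<close>. Naming the palette \<open>S\<close>, instead
  of bounding the number of colours, lets one palette be shared by all indices.\<close>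

definition coloured_in :: "'r set \<Rightarrow> ('r \<Rightarrow> nat) \<Rightarrow> ('m, 'r) struc \<Rightarrow> ('a, 'r) struc
    \<Rightarrow> ('m set \<Rightarrow> nat) \<Rightarrow> nat set \<Rightarrow> 'm set \<Rightarrow> bool" where
  "coloured_in L ar T A c S Y \<longleftrightarrow> (\<forall>X\<in>copies L ar T A. X \<subseteq> Y \<longrightarrow> c X \<in> S)"

lemma coloured_in_antimono: "coloured_in L ar T A c S Y \<Longrightarrow> X \<subseteq> Y \<Longrightarrow> coloured_in L ar T A c S X"
  unfolding coloured_in_def by blast

text \<open>The colouring is pulled back along \<open>e\<close>, the arrow yields a copy of
  \<open>B\<close> in \<open>C\<close> with few colours, and \<open>e\<close> carries that copy,
  with \<open>P\<close> placed on it, into \<open>T\<close>.\<close>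

lemma arrow_imp_coloured_in:
  assumes arr: "arrow L ar C B A k d" and e: "embedding L ar C T e"
    and c: "\<forall>X\<in>copies L ar T A. c X < k"
    and B: "isomorphic L ar P B"
  shows "\<exists>S\<subseteq>{..<k}. card S \<le> d \<and> (\<exists>h. embedding L ar P T h \<and> coloured_in L ar T A c S (h ` carr P))"
proof -
  have "\<forall>X\<in>copies L ar C A. c (e ` X) < k"
  proof
    fix X assume X: "X \<in> copies L ar C A"
    then have "X \<subseteq> carr C" unfolding copies_def by blast
    then show "c (e ` X) < k" using c X copies_embedding_image[OF e] by blast
  qed
  then obtain Y where Y: "Y \<in> copies L ar C B"
    and card: "card ((\<lambda>X. c (e ` X)) ` copies L ar (induced C Y) A) \<le> d"
    using arr[unfolded arrow_def, rule_format, of "\<lambda>X. c (e ` X)"] by blast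
  define S where "S = (\<lambda>X. c (e ` X)) ` copies L ar (induced C Y) A"
  have YC: "Y \<subseteq> carr C" and isoY: "isomorphic L ar (induced C Y) B"
    using Y unfolding copies_def by auto
  have "S \<subseteq> {..<k}"
    unfolding S_def copies_induced[OF YC] using \<open>\<forall>X\<in>copies L ar C A. c (e ` X) < k\<close> by auto
  have "isomorphic L ar P (induced C Y)"
    using B isomorphic_sym[OF isoY] by (rule isomorphic_trans)
  then obtain g where g: "embedding L ar P (induced C Y) g" "g ` carr P = Y"
    unfolding isomorphic_iff_embedding by auto
  have "embedding L ar P T (e \<circ> g)"
    using g(1) embedding_induced_subset[OF e YC] by (rule embedding_comp)
  moreover have "coloured_in L ar T A c S ((e \<circ> g) ` carr P)"
    unfolding coloured_in_def
  proof (intro ballI impI)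
    fix X assume X: "X \<in> copies L ar T A" "X \<subseteq> (e \<circ> g) ` carr P"
    then have "X \<subseteq> e ` Y" using g(2) by (metis image_comp)
    \<comment> \<open>A copy inside the image comes from a copy inside \<open>Y\<close>, whose
      colour was collected in \<open>S\<close>.\<close>
    then obtain X' where X': "X' \<subseteq> Y" "X = e ` X'" by (meson subset_imageE)
    then have "X' \<in> copies L ar (induced C Y) A"
      using X(1) copies_embedding_image[OF e, of X' A] YC copies_induced[OF YC] by blast
    then show "c X \<in> S" unfolding S_def X'(2) by blast
  qed
  ultimately show ?thesis using \<open>S \<subseteq> {..<k}\<close> card unfolding S_def by blast
qed

text \<open>The Ramsey witness for \<open>F\<close> embeds into some \<open>M i\<close>, hence by
  trending into D-many \<open>M t\<close>. Each such \<open>t\<close> in \<open>Z\<close> admits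
  some palette; there are finitely many palettes, so one of them serves D-many
  \<open>t\<close>.\<close>

lemma coloured_in_often_finite:
  assumes D: "ultrafilter_on_nat D" and trend: "trending L ar D M"
    and N: "is_struc L ar N" and age: "age L ar N \<subseteq> (\<Union>t. age L ar (M t))"
    and bound: "ramsey_bound L ar (age L ar N) A d"
    and Z: "Z \<in> D" and ct: "\<forall>t\<in>Z. \<forall>Y\<in>copies L ar (M t) A. ct t Y < k"
    and F: "finite F" "F \<subseteq> carr N"
  shows "\<exists>S\<subseteq>{..<k}. card S \<le> d \<and>
     {t. \<exists>h. embedding L ar (induced N F) (M t) h \<and> coloured_in L ar (M t) A (ct t) S (h ` F)} \<in> D"
proof -
  let ?\<S> = "{S. S \<subseteq> {..<k} \<and> card S \<le> d}"
  let ?X = "\<lambda>S. {t. \<exists>h. embedding L ar (induced N F) (M t) h \<and> coloured_in L ar (M t) A (ct t) S (h ` F)}"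
  obtain B where B: "B \<in> age L ar N" "isomorphic L ar (induced N F) B"
    using age_member_isomorphic_induced[OF N F] by blast
  obtain C where C: "C \<in> age L ar N" "arrow L ar C B A k d"
    using bound B(1) unfolding ramsey_bound_def by blast
  obtain i where "C \<in> age L ar (M i)" using C(1) age by blast
  then obtain e where e: "embedding L ar C (M i) e" unfolding age_def embeds_def by blast
  have "{t. embeds L ar (M i) (M t)} \<in> D" using trend unfolding trending_def by blast
  then have "(\<Union>S\<in>?\<S>. ?X S) \<in> D"
  proof (rule ultrafilter_mono2[OF D _ Z])
    fix t assume "t \<in> {t. embeds L ar (M i) (M t)}" "t \<in> Z"
    then obtain e' where e': "embedding L ar (M i) (M t) e'" unfolding embeds_def by blast
    from arrow_imp_coloured_in[OF C(2) embedding_comp[OF e e'] _ B(2)] ct \<open>t \<in> Z\<close>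
    show "t \<in> (\<Union>S\<in>?\<S>. ?X S)" by auto
  qed
  moreover have "finite ?\<S>" by (rule finite_subset[of _ "Pow {..<k}"]) auto
  ultimately show ?thesis using ultrafilter_finite_UN[OF D, of ?\<S> ?X] by blast
qed

text \<open>If each of the finitely many palettes failed at some finite set, the union of these sets
  would still have a working palette, which by heredity would work at its own failing set.\<close>

lemma coloured_in_often:
  assumes D: "ultrafilter_on_nat D" and trend: "trending L ar D M"
    and N: "is_struc L ar N" and age: "age L ar N \<subseteq> (\<Union>t. age L ar (M t))"
    and bound: "ramsey_bound L ar (age L ar N) A d"
    and Z: "Z \<in> D" and ct: "\<forall>t\<in>Z. \<forall>Y\<in>copies L ar (M t) A. ct t Y < k"
  shows "\<exists>S\<subseteq>{..<k}. card S \<le> d \<and> (\<forall>F. finite F \<longrightarrow> F \<subseteq> carr N \<longrightarrow>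
     {t. \<exists>h. embedding L ar (induced N F) (M t) h \<and> coloured_in L ar (M t) A (ct t) S (h ` F)} \<in> D)"
proof (rule ccontr)
  define \<S> where "\<S> = {S. S \<subseteq> {..<k} \<and> card S \<le> d}"
  define X where "X S F = {t. \<exists>h. embedding L ar (induced N F) (M t) h
      \<and> coloured_in L ar (M t) A (ct t) S (h ` F)}" for S F
  assume "\<not> ?thesis"
  then have "\<forall>S\<in>\<S>. \<exists>F. finite F \<and> F \<subseteq> carr N \<and> X S F \<notin> D"
    unfolding \<S>_def X_def by blast
  from bchoice[OF this] obtain F
    where F: "\<forall>S\<in>\<S>. finite (F S) \<and> F S \<subseteq> carr N \<and> X S (F S) \<notin> D" ..
  define G where "G = (\<Union>S\<in>\<S>. F S)"
  have "finite \<S>" unfolding \<S>_def by (rule finite_subset[of _ "Pow {..<k}"]) auto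
  then have "finite G" "G \<subseteq> carr N" unfolding G_def using F by auto
  from coloured_in_often_finite[OF assms this]
  obtain S where S: "S \<in> \<S>" "X S G \<in> D" unfolding \<S>_def X_def by blast
  have FS: "F S \<subseteq> G" unfolding G_def using S(1) by blast
  from S(2) have "X S (F S) \<in> D"
  proof (rule ultrafilter_mono[OF D])
    fix t assume "t \<in> X S G"
    then obtain h where "embedding L ar (induced N G) (M t) h"
      "coloured_in L ar (M t) A (ct t) S (h ` G)" unfolding X_def by blast
    then have "embedding L ar (induced N (F S)) (M t) h" "coloured_in L ar (M t) A (ct t) S (h ` F S)"
      using FS by (auto intro: embedding_induced_mono coloured_in_antimono[OF _ image_mono])
    then show "t \<in> X S (F S)" unfolding X_def by blast
  qed
  then show False using F S(1) by blast
qed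

theorem mainTheorem5:
  fixes L :: "'r set" and ar :: "'r \<Rightarrow> nat"
    and D :: "nat set set"
    and M :: "nat \<Rightarrow> ('m, 'r) struc"
    and N :: "('n, 'r) struc"
    and A :: "(nat, 'r) struc"
  assumes "finite L"
    and "ultrafilter_on_nat D" and "nonprincipal D"
    and "\<forall>t. is_struc L ar (M t) \<and> finite (carr (M t))"
    and "trending L ar D M"
    and "is_struc L ar N"
    and "card_le_aleph1 (carr N)"
    and "age L ar N \<subseteq> (\<Union>t. age L ar (M t))"
    and "A \<in> age L ar N"
    and "finite_small_ramsey_degree L ar (age L ar N) A"
  shows "\<forall>k. int_arrow L ar D M N A k (small_ramsey_degree L ar (age L ar N) A)"
proof -
  note D = assms(2)
  let ?Ms = "ultraproduct D M"
  define d where "d = small_ramsey_degree L ar (age L ar N) A"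
  have bound: "ramsey_bound L ar (age L ar N) A d"
    using assms(10) LeastI_ex unfolding d_def small_ramsey_degree_def finite_small_ramsey_degree_def
    by metis
  have finA: "finite (carr A)" using assms(9) unfolding age_def by blast
  have "\<exists>Y\<in>copies L ar ?Ms N. card (c ` copies L ar (induced ?Ms Y) A) \<le> d"
    if int: "internal_colouring L ar D M A k c" for k c
  proof -
    obtain Z ct where Z: "Z \<in> D" and ct: "\<forall>t\<in>Z. \<forall>Y\<in>copies L ar (M t) A. ct t Y < k"
      and c: "\<And>X j. X \<in> copies L ar ?Ms A \<Longrightarrow> c X = j \<longleftrightarrow>
            {t\<in>Z. isomorphic L ar (induced (M t) (slice X t)) (induced ?Ms X)
                  \<and> ct t (slice X t) = j} \<in> D"
      using int unfolding internal_colouring_def Let_def by blast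
    obtain S where S: "S \<subseteq> {..<k}" "card S \<le> d"
      and often: "\<And>F. finite F \<Longrightarrow> F \<subseteq> carr N \<Longrightarrow> {t. \<exists>h. embedding L ar (induced N F) (M t) h
          \<and> coloured_in L ar (M t) A (ct t) S (h ` F)} \<in> D"
      using coloured_in_often[OF D assms(5,6,8) bound Z ct] by blast
    have "\<exists>f. \<forall>F. finite F \<longrightarrow> F \<subseteq> carr N \<longrightarrow>
       {t. embedding L ar (induced N F) (M t) (\<lambda>u. f u t)
           \<and> coloured_in L ar (M t) A (ct t) S ((\<lambda>u. f u t) ` F)} \<in> D"
      by (rule ultraproduct_embedding_family[OF assms(1-3)])
        (erule (1) coloured_in_antimono, rule assms(7), erule (1) often)
    then obtain f where "\<forall>F. finite F \<longrightarrow> F \<subseteq> carr N \<longrightarrow>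
       {t. embedding L ar (induced N F) (M t) (\<lambda>u. f u t)
           \<and> coloured_in L ar (M t) A (ct t) S ((\<lambda>u. f u t) ` F)} \<in> D" ..
    note f = this[rule_format]
    let ?\<phi> = "\<lambda>u. uclass D (f u)"
    have emb: "embedding L ar N ?Ms ?\<phi>"
    proof (rule ultraproduct_embedding[OF D])
      fix F assume "finite F" "F \<subseteq> carr N"
      from f[OF this] show "{t. embedding L ar (induced N F) (M t) (\<lambda>u. f u t)} \<in> D"
        by (rule ultrafilter_mono[OF D]) blast
    qed
    let ?Y = "?\<phi> ` carr N"
    have Y: "?Y \<subseteq> carr ?Ms" using emb unfolding embedding_def by blast
    have "?Y \<in> copies L ar ?Ms N"
      unfolding copies_def using Y isomorphic_sym[OF isomorphic_embedding_image[OF emb]] by blast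
    \<comment> \<open>A copy of \<open>A\<close> is finite, so it is the image of a finite
      \<open>F\<close>, and all relevant properties hold together at one index \<open>t\<close>.
      There the slice of \<open>X\<close> is a copy of \<open>A\<close> inside a good image and has
      colour \<open>c X\<close>.\<close>
    moreover have "c X \<in> S" if "X \<in> copies L ar (induced ?Ms ?Y) A" for X
    proof -
      have X: "X \<in> copies L ar ?Ms A" "X \<subseteq> ?Y" using that copies_induced[OF Y] by blast+
      then have isoX: "isomorphic L ar (induced ?Ms X) A" unfolding copies_def by blast
      then have "finite X"
        using finA bij_betw_finite unfolding isomorphic_def by fastforce
      then obtain F where F: "F \<subseteq> carr N" "finite F" "X = ?\<phi> ` F"
        using X(2) by (meson finite_subset_image)
      \<comment> \<open>Internality of the colouring, instantiated with
        \<open>j = c X\<close>.\<close>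
      have 1: "{t\<in>Z. isomorphic L ar (induced (M t) (slice X t)) (induced ?Ms X)
                  \<and> ct t (slice X t) = c X} \<in> D"
        using c[OF X(1)] by blast
      have 2: "{t. \<forall>u\<in>F. rep (?\<phi> u) t = f u t} \<in> D" by (rule rep_uclass_finite[OF D F(2)])
      from ultrafilter_ex[OF D ultrafilter_Int[OF D ultrafilter_Int[OF D 1 2] f[OF F(2,1)]]]
      obtain t where iso: "isomorphic L ar (induced (M t) (slice X t)) (induced ?Ms X)"
        and col: "ct t (slice X t) = c X" and rep: "\<forall>u\<in>F. rep (?\<phi> u) t = f u t"
        and et: "embedding L ar (induced N F) (M t) (\<lambda>u. f u t)"
        and good: "coloured_in L ar (M t) A (ct t) S ((\<lambda>u. f u t) ` F)" by blast
      \<comment> \<open>Slices are computed from \<open>rep\<close>; at this \<open>t\<close> it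
        agrees with \<open>f\<close> on \<open>F\<close>.\<close>
      have sl: "slice X t = (\<lambda>u. f u t) ` F"
        unfolding slice_def F(3) image_image using rep by (auto intro: image_cong)
      have "slice X t \<subseteq> carr (M t)" using et unfolding sl embedding_def by simp
      then have "slice X t \<in> copies L ar (M t) A"
        unfolding copies_def using isomorphic_trans[OF iso isoX] by blast
      then have "ct t (slice X t) \<in> S" using good unfolding coloured_in_def sl by blast
      then show ?thesis using col by simp
    qed
    then have "card (c ` copies L ar (induced ?Ms ?Y) A) \<le> d"
      using S card_mono[of S] finite_subset[OF S(1)]
      by (meson finite_lessThan image_subsetI le_trans)
    ultimately show ?thesis by blast
  qed
  then show ?thesis unfolding int_arrow_def d_def by blast
qed

end
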